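(* Let $\mathbf{M}$ be a variety of universal algebras. If $B_1 \in \mathbf{M}$ is injective in $\mathbf{M}$, then $B_1$ is complete (closed to simple extensions) in $\mathbf{M}$.
   Context: $\mathbf{M}$ is a variety (equational class) of universal algebras (with finitary operations); all algebras below belong to $\mathbf{M}$. $A\le B$ means that $A$ is a subalgebra of $B$. An algebra $Q\in\mathbf{M}$ is injective in $\mathbf{M}$ if for every $B\in\mathbf{M}$, every subalgebra $A\le B$ and every homomorphism $f:A\to Q$ there is a homomorphism $g:B\to Q$ with $g|_A=f$. For a set $S$, $W(S)$ is the free algebra in $\mathbf{M}$ on $S$; its elements are classes $[w]$ of words (terms) $w$ over $S$. The underlying set of an algebra is used as a set of free generators without its operations, and $W(A)$ is regarded as a subalgebra of $W(A\cup\{a\})$. An algebra $A'\in\mathbf{M}$ is a simple extension of $A$ with element $a$ (possibly $a\in A$), written $A'=A\sqcup a$, if $A\le A'$ and $A\cup\{a\}$ generates $A'$. $Val_A:W(A)\to A$ and $Val_{A\sqcup a}:W(A\cup\{a\})\to A\sqcup a$ are the surjective homomorphisms extending the identity maps on $A$ and on $A\cup\{a\}$ respectively; $Ker_A$ and $Ker_{A\sqcup a}$ are their kernel congruences. The set of $a$-extension conditions for $A$ (given by $A\sqcup a$) is $Ker_{A\sqcup a}|_a := Ker_{A\sqcup a}\setminus Ker_A$. If $B\le B_1$ and $B\sqcup x$ is a simple extension of $B$, an element $b\in B_1$ satisfies the $x$-extension conditions $Ker_{B\sqcup x}|_x$ if $w(b)=w'(b)$ in $B_1$ for every $([w(x)],[w'(x)])\in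 Ker_{B\sqcup x}|_x$, where $w(b)$ is the value in $B_1$ of the word $w$ when each letter from $B$ is interpreted as itself and $x$ is interpreted as $b$. $B_1\in\mathbf{M}$ is complete (closed to simple extensions) in $\mathbf{M}$ if for each subalgebra $B\le B_1$ and each set of $x$-extension conditions $Ker_{B\sqcup x}|_x$ for $B$ (that is, for each simple extension $B\sqcup x\in\mathbf{M}$) there is $b\in B_1$ satisfying these conditions. *)

theory Defs
  imports Main
begin

text \<open>
  A signature is a partial function: its domain is the (possibly empty) set of operation symbols,
  its values are their (finite) arities.
\<close>

type_synonym 'f signature = "'f \<rightharpoonup> nat"

datatype ('f, 'v) trm = Var 'v | Op 'f "('f, 'v) trm list"

inductive_set terms :: "'f signature \<Rightarrow> 'v set \<Rightarrow> ('f, 'v) trm set"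
  for Sg :: "'f signature" and S :: "'v set"
where
  Var: "v \<in> S \<Longrightarrow> Var v \<in> terms Sg S"
| Op: "Sg f = Some (length ts) \<Longrightarrow> \<forall>t \<in> set ts. t \<in> terms Sg S \<Longrightarrow> Op f ts \<in> terms Sg S"

text \<open>
  Only the values of the operations on argument lists of the right length from the carrier are
  meaningful. Carriers may be empty (when there are no constants).
\<close>

record ('f, 'a) alg =
  carrier :: "'a set"
  opn :: "'f \<Rightarrow> 'a list \<Rightarrow> 'a"

definition algebra :: "'f signature \<Rightarrow> ('f, 'a) alg \<Rightarrow> bool" where
  "algebra Sg A \<longleftrightarrow>
    (\<forall>f as. Sg f = Some (length as) \<and> set as \<subseteq> carrier A \<longrightarrow> opn A f as \<in> carrier A)"

definition subalgebra :: "'f signature \<Rightarrow> ('f, 'a) alg \<Rightarrow> ('f, 'a) alg \<Rightarrow> bool" where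
  "subalgebra Sg A B \<longleftrightarrow> algebra Sg A \<and> algebra Sg B \<and> carrier A \<subseteq> carrier B \<and>
    (\<forall>f as. Sg f = Some (length as) \<and> set as \<subseteq> carrier A \<longrightarrow> opn A f as = opn B f as)"

definition is_hom :: "'f signature \<Rightarrow> ('f, 'a) alg \<Rightarrow> ('f, 'b) alg \<Rightarrow> ('a \<Rightarrow> 'b) \<Rightarrow> bool" where
  "is_hom Sg A B h \<longleftrightarrow> h ` carrier A \<subseteq> carrier B \<and>
    (\<forall>f as. Sg f = Some (length as) \<and> set as \<subseteq> carrier A \<longrightarrow>
      h (opn A f as) = opn B f (map h as))"

definition is_iso :: "'f signature \<Rightarrow> ('f, 'a) alg \<Rightarrow> ('f, 'b) alg \<Rightarrow> ('a \<Rightarrow> 'b) \<Rightarrow> bool" where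
  "is_iso Sg A B h \<longleftrightarrow> is_hom Sg A B h \<and> bij_betw h (carrier A) (carrier B)"

inductive_set generated :: "'f signature \<Rightarrow> ('f, 'a) alg \<Rightarrow> 'a set \<Rightarrow> 'a set"
  for Sg :: "'f signature" and A :: "('f, 'a) alg" and X :: "'a set"
where
  base: "a \<in> X \<Longrightarrow> a \<in> generated Sg A X"
| opn: "Sg f = Some (length as) \<Longrightarrow> \<forall>a \<in> set as. a \<in> generated Sg A X \<Longrightarrow>
    opn A f as \<in> generated Sg A X"

primrec eval :: "('f, 'a) alg \<Rightarrow> ('v \<Rightarrow> 'a) \<Rightarrow> ('f, 'v) trm \<Rightarrow> 'a" where
  "eval A v (Var x) = v x"
| "eval A v (Op f ts) = opn A f (map (eval A v) ts)"

text \<open>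
  A variety is given by a signature and a set of equations in countably many variables
  (which suffice, as operations are finitary). It is a class of algebras over every carrier type.
\<close>

type_synonym 'f equations = "(('f, nat) trm \<times> ('f, nat) trm) set"

definition equations_over :: "'f signature \<Rightarrow> 'f equations \<Rightarrow> bool" where
  "equations_over Sg E \<longleftrightarrow> E \<subseteq> terms Sg UNIV \<times> terms Sg UNIV"

definition variety :: "'f signature \<Rightarrow> 'f equations \<Rightarrow> ('f, 'a) alg set" where
  "variety Sg E = {A. algebra Sg A \<and>
    (\<forall>(l, r) \<in> E. \<forall>v. range v \<subseteq> carrier A \<longrightarrow> eval A v l = eval A v r)}"

text \<open>
  HOL cannot quantify over types inside a formula, so ``all algebras of the variety'' means all
  those whose carrier is a set of elements of a type \<^typ>\<open>'u\<close>, which is an explicit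
  parameter here and in the definition of completeness below.
\<close>

definition injective_in ::
  "'u itself \<Rightarrow> 'f signature \<Rightarrow> 'f equations \<Rightarrow> ('f, 'q) alg \<Rightarrow> bool" where
  "injective_in U Sg E Q \<longleftrightarrow> Q \<in> variety Sg E \<and>
    (\<forall>B :: ('f, 'u) alg. B \<in> variety Sg E \<longrightarrow>
      (\<forall>A f. subalgebra Sg A B \<and> is_hom Sg A Q f \<longrightarrow>
        (\<exists>g. is_hom Sg B Q g \<and> (\<forall>a \<in> carrier A. g a = f a))))"

text \<open>
  The least congruence on the terms over \<^term>\<open>S\<close> that contains all substitution instances of
  the equations: the quotient by it is the free algebra of the variety on \<^term>\<open>S\<close>.
\<close>

definition term_alg :: "'f signature \<Rightarrow> 'v set \<Rightarrow> ('f, ('f, 'v) trm) alg" where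
  "term_alg Sg S = \<lparr>carrier = terms Sg S, opn = Op\<rparr>"

inductive_set term_eq ::
  "'f signature \<Rightarrow> 'f equations \<Rightarrow> 'v set \<Rightarrow> (('f, 'v) trm \<times> ('f, 'v) trm) set"
  for Sg :: "'f signature" and E :: "'f equations" and S :: "'v set"
where
  inst: "(l, r) \<in> E \<Longrightarrow> range \<sigma> \<subseteq> terms Sg S \<Longrightarrow>
    (eval (term_alg Sg S) \<sigma> l, eval (term_alg Sg S) \<sigma> r) \<in> term_eq Sg E S"
| refl: "t \<in> terms Sg S \<Longrightarrow> (t, t) \<in> term_eq Sg E S"
| sym: "(s, t) \<in> term_eq Sg E S \<Longrightarrow> (t, s) \<in> term_eq Sg E S"
| trans: "(s, t) \<in> term_eq Sg E S \<Longrightarrow> (t, u) \<in> term_eq Sg E S \<Longrightarrow> (s, u) \<in> term_eq Sg E S"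
| cong: "Sg f = Some (length ss) \<Longrightarrow> list_all2 (\<lambda>s t. (s, t) \<in> term_eq Sg E S) ss ts \<Longrightarrow>
    (Op f ss, Op f ts) \<in> term_eq Sg E S"

definition free_alg ::
  "'f signature \<Rightarrow> 'f equations \<Rightarrow> 'v set \<Rightarrow> ('f, ('f, 'v) trm set) alg" where
  "free_alg Sg E S = \<lparr>carrier = terms Sg S // term_eq Sg E S,
    opn = (\<lambda>f cs. term_eq Sg E S `` {Op f ts | ts. list_all2 (\<in>) ts cs})\<rparr>"

text \<open>For \<^term>\<open>S \<subseteq> T\<close>, the embedding of the free algebra on \<^term>\<open>S\<close> into that on \<^term>\<open>T\<close>.\<close>

definition free_incl ::
  "'f signature \<Rightarrow> 'f equations \<Rightarrow> 'v set \<Rightarrow> ('f, 'v) trm set \<Rightarrow> ('f, 'v) trm set" where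
  "free_incl Sg E T c = term_eq Sg E T `` c"

definition Val :: "('f, 'a) alg \<Rightarrow> ('f, 'a) trm set \<Rightarrow> 'a" where
  "Val A c = the_elem (eval A (\<lambda>x. x) ` c)"

text \<open>
  The kernel of \<^term>\<open>Val A\<close> on the free algebra on \<^term>\<open>S\<close>, where \<^term>\<open>S\<close> is a subset
  of the carrier of \<^term>\<open>A\<close>.
\<close>

definition Ker :: "'f signature \<Rightarrow> 'f equations \<Rightarrow> 'a set \<Rightarrow> ('f, 'a) alg \<Rightarrow>
    (('f, 'a) trm set \<times> ('f, 'a) trm set) set" where
  "Ker Sg E S A = {(c, d). c \<in> carrier (free_alg Sg E S) \<and> d \<in> carrier (free_alg Sg E S) \<and>
    Val A c = Val A d}"

text \<open>\<^term>\<open>A'\<close> is a simple extension of \<^term>\<open>A\<close> with element \<^term>\<open>a\<close>.\<close>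

definition simple_extension :: "'f signature \<Rightarrow> 'f equations \<Rightarrow>
    ('f, 'a) alg \<Rightarrow> 'a \<Rightarrow> ('f, 'a) alg \<Rightarrow> bool" where
  "simple_extension Sg E A a A' \<longleftrightarrow> A \<in> variety Sg E \<and> A' \<in> variety Sg E \<and>
    subalgebra Sg A A' \<and> a \<in> carrier A' \<and>
    generated Sg A' (insert a (carrier A)) = carrier A'"

definition extension_conditions :: "'f signature \<Rightarrow> 'f equations \<Rightarrow>
    ('f, 'a) alg \<Rightarrow> 'a \<Rightarrow> ('f, 'a) alg \<Rightarrow> (('f, 'a) trm set \<times> ('f, 'a) trm set) set" where
  "extension_conditions Sg E A a A' =
    Ker Sg E (insert a (carrier A)) A' -
    map_prod (free_incl Sg E (insert a (carrier A))) (free_incl Sg E (insert a (carrier A))) `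
      Ker Sg E (carrier A) A"

text \<open>The letter \<^term>\<open>x\<close> is interpreted as \<^term>\<open>b\<close>, any other letter \<^term>\<open>y\<close> as \<^term>\<open>\<iota> y\<close>.\<close>

definition satisfies_conditions :: "('f, 'q) alg \<Rightarrow> ('u \<Rightarrow> 'q) \<Rightarrow> 'u \<Rightarrow>
    (('f, 'u) trm set \<times> ('f, 'u) trm set) set \<Rightarrow> 'q \<Rightarrow> bool" where
  "satisfies_conditions Q \<iota> x K b \<longleftrightarrow>
    (\<forall>(c, d) \<in> K. \<forall>w \<in> c. \<forall>w' \<in> d. eval Q (\<iota>(x := b)) w = eval Q (\<iota>(x := b)) w')"

text \<open>
  A simple extension of a subalgebra \<^term>\<open>B\<close> of \<^term>\<open>Q\<close> contains \<^term>\<open>B\<close>, and its new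
  elements need not fit into the carrier type of \<^term>\<open>Q\<close>. So \<^term>\<open>B\<close> is first replaced by an
  arbitrary isomorphic copy \<^term>\<open>B'\<close> over the type \<^typ>\<open>'u\<close>, and the letters from \<^term>\<open>B'\<close> are
  interpreted through the isomorphism. If \<^typ>\<open>'u\<close> is the carrier type of \<^term>\<open>Q\<close>, then
  \<^term>\<open>B' = B\<close> with the identity is one of the cases; if \<^typ>\<open>'u\<close> is the type
  \<^typ>\<open>('f, 'q option) trm set\<close>, then up to isomorphism over \<^term>\<open>B\<close> all simple extensions occur.
\<close>

definition complete_in ::
  "'u itself \<Rightarrow> 'f signature \<Rightarrow> 'f equations \<Rightarrow> ('f, 'q) alg \<Rightarrow> bool" where
  "complete_in U Sg E Q \<longleftrightarrow> Q \<in> variety Sg E \<and>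
    (\<forall>B. subalgebra Sg B Q \<longrightarrow>
      (\<forall>(B' :: ('f, 'u) alg) \<iota> x C. is_iso Sg B' B \<iota> \<and> simple_extension Sg E B' x C \<longrightarrow>
        (\<exists>b \<in> carrier Q.
          satisfies_conditions Q \<iota> x (extension_conditions Sg E B' x C) b)))"

end

theory Submission
  imports Defs
begin

text \<open>
  An embedding of \<open>B'\<close> into the injective algebra \<open>B1\<close> extends to a homomorphism \<open>g\<close> on the simple
  extension \<open>C\<close> of \<open>B'\<close> by \<open>x\<close>. Evaluating words at \<open>g x\<close> amounts to evaluating them in \<open>C\<close> and
  applying \<open>g\<close>, so \<open>g x\<close> satisfies every identity between words that holds in \<open>C\<close>.
\<close>

lemma eval_in_carrier:
  assumes "algebra Sg A" and "t \<in> terms Sg S" and "v ` S \<subseteq> carrier A"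
  shows "eval A v t \<in> carrier A"
  using assms(2)
proof (induction rule: terms.induct)
  case (Var x)
  then show ?case using assms(3) by auto
next
  case (Op f ts)
  then have "set (map (eval A v) ts) \<subseteq> carrier A" by auto
  moreover have "Sg f = Some (length (map (eval A v) ts))" using Op.hyps(1) by simp
  ultimately show ?case using assms(1) unfolding algebra_def eval.simps by blast
qed

text \<open>Induction on terms. The assignment \<open>u\<close> is tied to \<open>h\<close> composed
  with \<open>v\<close> only on the letters in \<open>S\<close>, because
  \<open>\<iota>(x := g x)\<close> and \<open>g\<close> need not agree outside the carrier of
  \<open>B'\<close> and \<open>x\<close>.\<close>

lemma eval_hom:
  assumes "algebra Sg A" and "is_hom Sg A B h" and "t \<in> terms Sg S" and "v ` S \<subseteq> carrier A"
    and "\<And>y. y \<in> S \<Longrightarrow> u y = h (v y)"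
  shows "eval B u t = h (eval A v t)"
  using assms(3)
proof (induction rule: terms.induct)
  case (Var x)
  then show ?case using assms(5) by simp
next
  case (Op f ts)
  have "set (map (eval A v) ts) \<subseteq> carrier A"
    using Op.IH eval_in_carrier[OF assms(1) _ assms(4)] by auto
  moreover have "Sg f = Some (length (map (eval A v) ts))" using Op.hyps by simp
  ultimately have "h (opn A f (map (eval A v) ts)) = opn B f (map h (map (eval A v) ts))"
    using assms(2) unfolding is_hom_def by blast
  moreover have "map (eval B u) ts = map h (map (eval A v) ts)"
    using Op.IH by simp
  ultimately show ?case by (simp only: eval.simps)
qed

text \<open>The substitution lemma: evaluation in the term algebra is substitution, since its
  operations are the constructors \<open>Op f\<close>.\<close>

lemma eval_term_alg: "eval A v (eval (term_alg Sg S) \<sigma> t) = eval A (\<lambda>n. eval A v (\<sigma> n)) t"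
proof (induction t)
  case (Var x)
  then show ?case by simp
next
  case (Op f ts)
  have "opn (term_alg Sg S) f us = Op f us" for us
    by (simp add: term_alg_def)
  with Op show ?case by (simp cong: map_cong)
qed

text \<open>Soundness of equational logic. By the substitution lemma, an instance of an equation
  under \<open>\<sigma>\<close> is the equation itself at the assignment of the values of
  \<open>\<sigma> n\<close>, which lie in the carrier.\<close>

lemma term_eq_sound:
  assumes A: "A \<in> variety Sg E" and v: "v ` S \<subseteq> carrier A" and st: "(s, t) \<in> term_eq Sg E S"
  shows "eval A v s = eval A v t"
  using st
proof (induction rule: term_eq.induct)
  case (inst l r \<sigma>)
  have "algebra Sg A" using A by (simp add: variety_def)
  then have "range (\<lambda>n. eval A v (\<sigma> n)) \<subseteq> carrier A"
    using inst(2) eval_in_carrier[OF _ _ v] by blast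
  then show ?case
    using A inst(1) unfolding variety_def eval_term_alg by blast
next
  case (cong f ss ts)
  then have "map (eval A v) ss = map (eval A v) ts"
    by (auto simp: list_all2_conv_all_nth intro: nth_equalityI)
  then show ?case by simp
qed auto

lemma free_alg_representative:
  assumes "c \<in> carrier (free_alg Sg E S)"
  obtains t where "t \<in> terms Sg S" and "c = term_eq Sg E S `` {t}"
  using assms unfolding free_alg_def by (auto elim: quotientE)

text \<open>By soundness evaluation is constant on the class, so the image inside
  \<open>the_elem\<close> is a singleton.\<close>

lemma Val_term_eq_class:
  assumes "A \<in> variety Sg E" and "S \<subseteq> carrier A" and "t \<in> terms Sg S"
  shows "Val A (term_eq Sg E S `` {t}) = eval A (\<lambda>y. y) t"
proof -
  have t: "t \<in> term_eq Sg E S `` {t}"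
    using term_eq.refl[OF assms(3)] by simp
  have "eval A (\<lambda>y. y) s = eval A (\<lambda>y. y) t" if "s \<in> term_eq Sg E S `` {t}" for s
  proof -
    have "(t, s) \<in> term_eq Sg E S" using that by simp
    from term_eq_sound[OF assms(1) _ this, of "\<lambda>y. y"] assms(2)
    have "eval A (\<lambda>y. y) t = eval A (\<lambda>y. y) s" by simp
    then show ?thesis by simp
  qed
  then show ?thesis
    unfolding Val_def using t by (intro the_elem_image_unique) blast+
qed

text \<open>The right-hand side depends on \<open>c\<close> only through \<open>Val C c\<close>, so
  two classes related by the kernel receive the same value in \<open>Q\<close>.\<close>

lemma eval_hom_free_alg_class:
  assumes C: "C \<in> variety Sg E" and Q: "Q \<in> variety Sg E" and g: "is_hom Sg C Q g"
    and S: "S \<subseteq> carrier C" and u: "\<And>y. y \<in> S \<Longrightarrow> u y = g y"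
    and c: "c \<in> carrier (free_alg Sg E S)" and w: "w \<in> c"
  shows "eval Q u w = g (Val C c)"
proof -
  obtain t where t: "t \<in> terms Sg S" "c = term_eq Sg E S `` {t}"
    using free_alg_representative[OF c] .
  have "u ` S \<subseteq> carrier Q"
    using u S g unfolding is_hom_def by auto
  \<comment> \<open>The representative \<open>t\<close> is known to be a term over \<open>S\<close>,
    as \<open>eval_hom\<close> requires; soundness in \<open>Q\<close> moves from \<open>w\<close>
    to \<open>t\<close>.\<close>
  then have "eval Q u w = eval Q u t"
    using term_eq_sound[OF Q, of u S t w] t(2) w by simp
  also have "\<dots> = g (eval C (\<lambda>y. y) t)"
    using C S u by (intro eval_hom[OF _ g t(1)]) (auto simp: variety_def)
  also have "eval C (\<lambda>y. y) t = Val C c"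
    using Val_term_eq_class[OF C S t(1)] t(2) by simp
  finally show ?thesis .
qed

lemma is_hom_into_superalgebra:
  assumes "is_hom Sg A B h" and "subalgebra Sg B Q"
  shows "is_hom Sg A Q h"
  unfolding is_hom_def
proof (intro conjI allI impI)
  show "h ` carrier A \<subseteq> carrier Q"
    using assms unfolding is_hom_def subalgebra_def by blast
next
  fix f as
  assume as: "Sg f = Some (length as) \<and> set as \<subseteq> carrier A"
  then have "Sg f = Some (length (map h as))" and "set (map h as) \<subseteq> carrier B"
    using assms(1) unfolding is_hom_def by auto
  then have "opn B f (map h as) = opn Q f (map h as)"
    using assms(2) unfolding subalgebra_def by blast
  then show "h (opn A f as) = opn Q f (map h as)"
    using as assms(1) unfolding is_hom_def by simp
qed

theorem proposition4:
  fixes Sg :: "'f signature" and E :: "'f equations" and B1 :: "('f, 'a) alg"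
  assumes "equations_over Sg E"
    and "B1 \<in> variety Sg E"
    and "injective_in TYPE('u) Sg E B1"
  shows "complete_in TYPE('u) Sg E B1"
  unfolding complete_in_def
proof (intro conjI allI impI)
  show "B1 \<in> variety Sg E" by fact
next
  fix B and B' :: "('f, 'u) alg" and \<iota> x C
  assume B: "subalgebra Sg B B1" and "is_iso Sg B' B \<iota> \<and> simple_extension Sg E B' x C"
  then have \<iota>: "is_hom Sg B' B1 \<iota>" and C: "C \<in> variety Sg E" and sub: "subalgebra Sg B' C"
    and x: "x \<in> carrier C"
    by (auto simp: is_iso_def simple_extension_def intro: is_hom_into_superalgebra)
  \<comment> \<open>Injectivity is applied to the pair \<open>B'\<close>, \<open>C\<close> over
    \<open>'u\<close>, extending \<open>\<iota>\<close> viewed as a map into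
    \<open>B1\<close>.\<close>
  then obtain g where g: "is_hom Sg C B1 g" and g\<iota>: "\<forall>a \<in> carrier B'. g a = \<iota> a"
    using assms(3) unfolding injective_in_def by meson
  let ?S = "insert x (carrier B')"
  have S: "?S \<subseteq> carrier C" using x sub by (simp add: subalgebra_def)
  \<comment> \<open>If \<open>x\<close> already lies in \<open>B'\<close>, the update at
    \<open>x\<close> changes nothing, since then \<open>g x = \<iota> x\<close>; so the assignment
    agrees with \<open>g\<close> on all of \<open>?S\<close> in either case.\<close>
  have "eval B1 (\<iota>(x := g x)) w = g (Val C c)"
    if "c \<in> carrier (free_alg Sg E ?S)" "w \<in> c" for c w
    using g\<iota> that by (intro eval_hom_free_alg_class[OF C assms(2) g S]) auto
  then have "satisfies_conditions B1 \<iota> x (extension_conditions Sg E B' x C) (g x)"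
    by (auto simp: satisfies_conditions_def extension_conditions_def Ker_def)
  moreover have "g x \<in> carrier B1" using g x by (auto simp: is_hom_def)
  ultimately show "\<exists>b \<in> carrier B1.
      satisfies_conditions B1 \<iota> x (extension_conditions Sg E B' x C) b"
    by blast
qed

end
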